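(* Let $\ell\ge1$ be an integer and let $\lambda=(\lambda_1,\lambda_2,\dots,\lambda_r)$ be a partition. Then $$\Sigma_\lambda(\ell)=\sum_{\lambda=\bigsqcup_{j\in J}\lambda^{(j)}}\ell^{\#J}\cdot\prod_{j\in J}(-1)^{\#\lambda^{(j)}-1}\left(\#\lambda^{(j)}-1\right)!$$ where the sum is over all the partitions $\lambda=\bigsqcup_{j\in J}\lambda^{(j)}$ of $\lambda$ as a set such that for each $j\in J$ the sum $|\lambda^{(j)}|$ of the elements of $\lambda^{(j)}$ is a multiple of $\ell$, and $\#\lambda^{(j)}$ is the cardinality of the subset $\lambda^{(j)}$.
   Context: Let $\zeta_\ell$ be a primitive $\ell$-th root of unity. For a tuple $\lambda=(\lambda_1,\dots,\lambda_r)$ of integers, define $$\Sigma_\lambda(\ell)=\sum_{\iota=(\iota_1,\dots,\iota_r)}\zeta_\ell^{\iota_1\lambda_1+\iota_2\lambda_2+\dots+\iota_r\lambda_r},$$ where the sum ranges over all $r$-tuples $\iota$ of pairwise distinct integers with $0\le\iota_i\le\ell-1$ for each $i$. A partition $\lambda=(\lambda_1,\dots,\lambda_r)$ is a tuple of positive integers. "Partition of $\lambda$ as a set" means a set partition of the index set $\{1,\dots,r\}$ into nonempty blocks (so equal parts with different indices are regarded as distinct elements); the block indexed by $j\in J$ gives $\lambda^{(j)}$, consisting of the $\lambda_i$ with $i$ in the block. *)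

theory Defs
  imports Complex_Main "HOL-Library.Disjoint_Sets"
begin

definition primitive_root_of_unity :: "nat \<Rightarrow> complex \<Rightarrow> bool" where
  "primitive_root_of_unity l \<zeta> \<longleftrightarrow>
     l > 0 \<and> \<zeta> ^ l = 1 \<and> (\<forall>k. 0 < k \<and> k < l \<longrightarrow> \<zeta> ^ k \<noteq> 1)"

text \<open>
  Tuples are lists, so their entries are indexed by \<open>{..<r}\<close> instead of \<open>{1..r}\<close>.
\<close>

definition index_tuples :: "nat \<Rightarrow> nat \<Rightarrow> int list set" where
  "index_tuples l r = {\<iota>. length \<iota> = r \<and> distinct \<iota> \<and> set \<iota> \<subseteq> {0..int l - 1}}"

text \<open>Meant for a primitive \<open>l\<close>-th root of unity \<open>\<zeta>\<close>.\<close>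

definition Sigma_sum :: "complex \<Rightarrow> int list \<Rightarrow> nat \<Rightarrow> complex" where
  "Sigma_sum \<zeta> lam l =
     (\<Sum>\<iota>\<in>index_tuples l (length lam). \<zeta> powi (\<Sum>i<length lam. \<iota> ! i * lam ! i))"

text \<open>
  Positive integers, not required to be sorted; the empty tuple is allowed.
\<close>

definition is_partition :: "int list \<Rightarrow> bool" where
  "is_partition lam \<longleftrightarrow> (\<forall>x\<in>set lam. x > 0)"

text \<open>
  Set partitions of the index set, so that equal parts at different positions are distinct
  elements. A partition \<open>J\<close> is represented by its set of blocks.
\<close>

definition admissible_partitions :: "nat \<Rightarrow> int list \<Rightarrow> nat set set set" where
  "admissible_partitions l lam =
     {J. partition_on {..<length lam} J \<and> (\<forall>B\<in>J. int l dvd (\<Sum>i\<in>B. lam ! i))}"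

end

theory Submission
  imports Defs "HOL-Library.FuncSet"
begin

text \<open>
  Sums over injective maps and sums over set partitions satisfy the same recursion when an index
  \<open>a\<close> is added. On the first side the value at \<open>a\<close> ranges over all of \<open>X\<close> minus the values already
  taken, and the term excluding the value at \<open>j\<close> replaces \<open>f j\<close> by \<open>f a * f j\<close>. On the other side
  \<open>a\<close> forms a new block or joins a block \<open>B\<close>; the weight \<open>(-1) ^ (n - 1) * (n - 1)!\<close> picks up the
  factor \<open>- card B\<close>, one \<open>-1\<close> for each \<open>j \<in> B\<close>. With \<open>f i x = \<zeta> powi (x * lam ! i)\<close> the power
  sum of a block is \<open>l\<close> or \<open>0\<close>, according to whether \<open>l\<close> divides the sum of its parts.
\<close>

section \<open>Adding one index to set partitions and to injective maps\<close>

text \<open>Deleting \<open>a\<close> from a partition of \<open>insert a A\<close> leaves a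
  partition \<open>P\<close> of \<open>A\<close>. The original is recovered from \<open>P\<close>
  once it is known whether \<open>a\<close> was alone or from which block it was removed.\<close>

lemma sum_partition_on_insert:
  assumes "finite A" "a \<notin> A"
  shows "(\<Sum>Q | partition_on (insert a A) Q. F Q) =
    (\<Sum>P | partition_on A P. F (insert {a} P) + (\<Sum>B\<in>P. F (insert (insert a B) (P - {B}))))"
proof -
  \<comment> \<open>\<open>B = {}\<close> encodes the case where \<open>a\<close> forms a block of its own.\<close>
  let ?S = "SIGMA P:{P. partition_on A P}. insert {} P"
  have fin: "finite {P. partition_on A P}"
    using finitely_many_partition_on[OF assms(1)] .
  have finP: "finite P" if "partition_on A P" for P
    using finite_elements[OF assms(1) that] .
  have "(\<Sum>P | partition_on A P. F (insert {a} P) + (\<Sum>B\<in>P. F (insert (insert a B) (P - {B})))) =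
    (\<Sum>P | partition_on A P. \<Sum>B\<in>insert {} P. F (insert (insert a B) (P - {B})))"
  proof (rule sum.cong[OF refl], clarify)
    fix P assume P: "partition_on A P"
    then have "{} \<notin> P" by (simp add: partition_on_def)
    then show "F (insert {a} P) + (\<Sum>B\<in>P. F (insert (insert a B) (P - {B}))) =
      (\<Sum>B\<in>insert {} P. F (insert (insert a B) (P - {B})))"
      using finP[OF P] by simp
  qed
  also have "\<dots> = (\<Sum>(P, B)\<in>?S. F (insert (insert a B) (P - {B})))"
    by (rule sum.Sigma) (use fin finP in auto)
  also have "\<dots> = (\<Sum>Q | partition_on (insert a A) Q. F Q)"
  proof -
    let ?h = "\<lambda>(P, B). insert (insert a B) (P - {B})"
    let ?blk = "\<lambda>Q. THE C. C \<in> Q \<and> a \<in> C"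
    \<comment> \<open>\<open>?k\<close> takes \<open>a\<close> out of its block. Subtracting
      \<open>{{}}\<close> discards the remainder if \<open>a\<close> was alone, and the second
      component is then \<open>{}\<close>.\<close>
    let ?k = "\<lambda>Q. (Q - {?blk Q} \<union> ({?blk Q - {a}} - {{}}), ?blk Q - {a})"
    have blkI: "?blk Q = C" if "partition_on (insert a A) Q" "C \<in> Q" "a \<in> C" for Q C
      using that by (intro the_equality) (auto simp: partition_on_def disjoint_def)
    have part: "partition_on (insert a A) (insert (insert a B) (P - {B}))"
      if P: "partition_on A P" and B: "B \<in> insert {} P" for P B
    proof (rule partition_onI)
      show "\<Union> (insert (insert a B) (P - {B})) = insert a A"
        using that unfolding partition_on_def by blast
      have sub: "\<forall>C\<in>P. a \<notin> C" using P assms(2) unfolding partition_on_def by blast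
      show "disjnt p q" if "p \<in> insert (insert a B) (P - {B})" "q \<in> insert (insert a B) (P - {B})"
        "p \<noteq> q" for p q
        using that P B sub unfolding partition_on_def disjoint_def disjnt_def by blast
    qed (use P in \<open>auto simp: partition_on_def\<close>)
    show ?thesis
    proof (rule sum.reindex_bij_witness[where i = ?k and j = ?h])
      fix z assume "z \<in> ?S"
      then obtain P B where z: "z = (P, B)" and P: "partition_on A P" and B: "B \<in> insert {} P"
        by auto
      have aB: "a \<notin> B" and ne: "{} \<notin> P" and iP: "insert a B \<notin> P"
        using P B assms(2) unfolding partition_on_def by blast+
      have blk: "?blk (?h z) = insert a B"
        unfolding z prod.case by (rule blkI[OF part[OF P B]]) auto
      have "insert a B - {a} = B" using aB by blast
      then show "?k (?h z) = z"
        unfolding blk using B iP ne by (auto simp: z)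
      show "?h z \<in> {Q. partition_on (insert a A) Q}"
        using part[OF P B] z by simp
      show "F (?h z) = (case z of (P, B) \<Rightarrow> F (insert (insert a B) (P - {B})))"
        by (simp add: z)
    next
      fix Q assume "Q \<in> {Q. partition_on (insert a A) Q}"
      then have Q: "partition_on (insert a A) Q" by simp
      then obtain C where C: "C \<in> Q" "a \<in> C" by (auto simp: partition_on_def)
      note blk = blkI[OF Q C]
      have dj: "\<And>D. D \<in> Q \<Longrightarrow> D \<noteq> C \<Longrightarrow> D \<inter> C = {}" and ne: "{} \<notin> Q" and un: "\<Union>Q = insert a A"
        and dQ: "\<And>D E. D \<in> Q \<Longrightarrow> E \<in> Q \<Longrightarrow> D \<noteq> E \<Longrightarrow> D \<inter> E = {}"
        using Q C unfolding partition_on_def disjoint_def by blast+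
      \<comment> \<open>\<open>?h\<close> deletes \<open>C - {a}\<close> again, so the round trip
        would lose a block if \<open>C - {a}\<close> were already in \<open>Q\<close>. Such a block
        would be disjoint from \<open>C\<close>, hence empty.\<close>
      have nin: "C - {a} \<notin> Q"
      proof
        assume D: "C - {a} \<in> Q"
        have "C - {a} \<noteq> C" using C(2) by blast
        from dj[OF D this] have "C - {a} = {}" by blast
        with D ne show False by simp
      qed
      show "?h (?k Q) = Q"
        unfolding blk using C nin by (auto simp: insert_absorb)
      have "partition_on A (Q - {C} \<union> ({C - {a}} - {{}}))"
      proof (rule partition_onI)
        have "\<Union> (Q - {C} \<union> ({C - {a}} - {{}})) = \<Union>Q - {a}"
          using C dj by blast
        then show "\<Union> (Q - {C} \<union> ({C - {a}} - {{}})) = A" using un assms(2) by simp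
        show "disjnt p q" if "p \<in> Q - {C} \<union> ({C - {a}} - {{}})" "q \<in> Q - {C} \<union> ({C - {a}} - {{}})"
          "p \<noteq> q" for p q
          using that dQ dj unfolding disjnt_def by blast
      qed (use ne in auto)
      then show "?k Q \<in> ?S"
        unfolding blk by auto
    qed
  qed
  finally show ?thesis ..
qed

lemma sum_inj_PiE_insert:
  assumes "finite A" "a \<notin> A" "finite X"
  shows "(\<Sum>g | g \<in> insert a A \<rightarrow>\<^sub>E X \<and> inj_on g (insert a A). F g) =
    (\<Sum>g | g \<in> A \<rightarrow>\<^sub>E X \<and> inj_on g A. \<Sum>x\<in>X - g ` A. F (g(a := x)))"
proof -
  let ?I = "{g. g \<in> A \<rightarrow>\<^sub>E X \<and> inj_on g A}"
  have fin: "finite ?I"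
    by (rule finite_subset[OF _ finite_PiE[of A "\<lambda>_. X"]]) (use assms in auto)
  have "(\<Sum>g\<in>?I. \<Sum>x\<in>X - g ` A. F (g(a := x))) =
    (\<Sum>(g, x)\<in>(SIGMA g:?I. X - g ` A). F (g(a := x)))"
    by (rule sum.Sigma) (use fin assms in auto)
  also have "\<dots> = (\<Sum>g | g \<in> insert a A \<rightarrow>\<^sub>E X \<and> inj_on g (insert a A). F g)"
  \<comment> \<open>Members of \<open>A \<rightarrow>\<^sub>E X\<close> take the value
    \<open>undefined\<close> outside \<open>A\<close>, so restricting \<open>g\<close> to
    \<open>A\<close> means resetting its value at \<open>a\<close> to
    \<open>undefined\<close>.\<close>
  proof (rule sum.reindex_bij_witness[where i = "\<lambda>g. (g(a := undefined), g a)"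
        and j = "\<lambda>(g, x). g(a := x)"])
    fix z assume "z \<in> (SIGMA g:?I. X - g ` A)"
    then obtain g x where z: "z = (g, x)" and g: "g \<in> A \<rightarrow>\<^sub>E X" "inj_on g A" "x \<in> X" "x \<notin> g ` A"
      by auto
    have "g a = undefined" using g assms(2) by (auto simp: PiE_def extensional_def)
    then show "((case z of (g, x) \<Rightarrow> g(a := x))(a := undefined), (case z of (g, x) \<Rightarrow> g(a := x)) a) = z"
      by (auto simp: z)
    show "(case z of (g, x) \<Rightarrow> g(a := x)) \<in> {g. g \<in> insert a A \<rightarrow>\<^sub>E X \<and> inj_on g (insert a A)}"
      using g assms(2) by (auto simp: z inj_on_fun_updI PiE_def extensional_def)
  next
    fix g assume g: "g \<in> {g. g \<in> insert a A \<rightarrow>\<^sub>E X \<and> inj_on g (insert a A)}"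
    have "(g(a := undefined)) ` A = g ` A" using assms(2) by auto
    moreover have "inj_on (g(a := undefined)) A"
      using g assms(2) by (auto simp: inj_on_def)
    ultimately show "(g(a := undefined), g a) \<in> (SIGMA g:?I. X - g ` A)"
      using g assms(2) by (auto simp: PiE_def extensional_def)
  qed auto
  finally show ?thesis ..
qed


section \<open>Block weights and the expansion over set partitions\<close>

text \<open>The signed factorial is the Moebius function of the lattice of partitions of
  \<open>B\<close>, taken from the partition into singletons to the single block. The other factor
  is the power sum in which all indices in \<open>B\<close> share one value.\<close>

abbreviation block_weight :: "('a \<Rightarrow> 'b \<Rightarrow> 'c) \<Rightarrow> 'b set \<Rightarrow> 'a set \<Rightarrow> 'c::{comm_ring_1,ring_char_0}"
  where "block_weight f X B \<equiv>
    (-1) ^ (card B - 1) * fact (card B - 1) * (\<Sum>x\<in>X. \<Prod>i\<in>B. f i x)"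

lemma sum_inj_prod_insert:
  fixes f :: "'a \<Rightarrow> 'b \<Rightarrow> 'c::comm_ring_1"
  assumes "finite A" "a \<notin> A" "finite X"
  shows "(\<Sum>g | g \<in> insert a A \<rightarrow>\<^sub>E X \<and> inj_on g (insert a A). \<Prod>i\<in>insert a A. f i (g i)) =
    (\<Sum>x\<in>X. f a x) * (\<Sum>g | g \<in> A \<rightarrow>\<^sub>E X \<and> inj_on g A. \<Prod>i\<in>A. f i (g i)) -
    (\<Sum>j\<in>A. \<Sum>g | g \<in> A \<rightarrow>\<^sub>E X \<and> inj_on g A. \<Prod>i\<in>A. (f(j := \<lambda>x. f a x * f j x)) i (g i))"
proof -
  let ?I = "{g. g \<in> A \<rightarrow>\<^sub>E X \<and> inj_on g A}"
  have step: "(\<Sum>x\<in>X - g ` A. \<Prod>i\<in>insert a A. f i ((g(a := x)) i)) =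
      (\<Sum>x\<in>X. f a x) * (\<Prod>i\<in>A. f i (g i)) -
      (\<Sum>j\<in>A. \<Prod>i\<in>A. (f(j := \<lambda>x. f a x * f j x)) i (g i))"
    if g: "g \<in> A \<rightarrow>\<^sub>E X" "inj_on g A" for g
  proof -
    have sub: "g ` A \<subseteq> X" using g by auto
    have upd: "(\<Prod>i\<in>A. f i ((g(a := x)) i)) = (\<Prod>i\<in>A. f i (g i))" for x
      using assms(2) by (intro prod.cong) auto
    have "(\<Sum>x\<in>X - g ` A. \<Prod>i\<in>insert a A. f i ((g(a := x)) i)) =
        (\<Sum>x\<in>X - g ` A. f a x) * (\<Prod>i\<in>A. f i (g i))"
      using assms by (simp add: upd sum_distrib_right del: fun_upd_apply) simp
    \<comment> \<open>Injectivity of \<open>g\<close> lets the excluded sum over the image of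
      \<open>A\<close> be indexed by \<open>j \<in> A\<close>.\<close>
    also have "(\<Sum>x\<in>X - g ` A. f a x) = (\<Sum>x\<in>X. f a x) - (\<Sum>j\<in>A. f a (g j))"
      using sum_diff[OF assms(3) sub, of "f a"] sum.reindex[OF g(2), of "f a"] by simp
    also have "(\<Sum>j\<in>A. f a (g j)) * (\<Prod>i\<in>A. f i (g i)) =
        (\<Sum>j\<in>A. \<Prod>i\<in>A. (f(j := \<lambda>x. f a x * f j x)) i (g i))"
      unfolding sum_distrib_right
    proof (rule sum.cong[OF refl])
      fix j assume j: "j \<in> A"
      have "(\<Prod>i\<in>A - {j}. (f(j := \<lambda>x. f a x * f j x)) i (g i)) = (\<Prod>i\<in>A - {j}. f i (g i))"
        by (rule prod.cong) auto
      then show "f a (g j) * (\<Prod>i\<in>A. f i (g i)) =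
          (\<Prod>i\<in>A. (f(j := \<lambda>x. f a x * f j x)) i (g i))"
        by (simp add: prod.remove[OF assms(1) j] mult.assoc del: fun_upd_apply) simp
    qed
    ultimately show ?thesis by (simp add: left_diff_distrib del: fun_upd_apply)
  qed
  have "(\<Sum>g | g \<in> insert a A \<rightarrow>\<^sub>E X \<and> inj_on g (insert a A). \<Prod>i\<in>insert a A. f i (g i)) =
      (\<Sum>g\<in>?I. (\<Sum>x\<in>X. f a x) * (\<Prod>i\<in>A. f i (g i)) -
        (\<Sum>j\<in>A. \<Prod>i\<in>A. (f(j := \<lambda>x. f a x * f j x)) i (g i)))"
    unfolding sum_inj_PiE_insert[OF assms] by (rule sum.cong[OF refl]) (use step in blast)
  also have "\<dots> = (\<Sum>x\<in>X. f a x) * (\<Sum>g\<in>?I. \<Prod>i\<in>A. f i (g i)) -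
      (\<Sum>j\<in>A. \<Sum>g\<in>?I. \<Prod>i\<in>A. (f(j := \<lambda>x. f a x * f j x)) i (g i))"
    unfolding sum_subtractf sum_distrib_left by (subst sum.swap) (rule refl)
  finally show ?thesis .
qed

text \<open>Moving \<open>f a\<close> into any factor \<open>j \<in> B\<close> gives the same
  product, that over \<open>insert a B\<close>. The sum therefore has \<open>card B\<close> equal
  terms, and this count turns \<open>fact (card B - 1)\<close> into
  \<open>fact (card B)\<close>.\<close>

lemma block_weight_insert:
  assumes "finite B" "B \<noteq> {}" "a \<notin> B"
  shows "block_weight f X (insert a B) = - (\<Sum>j\<in>B. block_weight (f(j := \<lambda>x. f a x * f j x)) X B)"
proof -
  obtain n where n: "card B = Suc n"
    using assms by (metis card_gt_0_iff gr0_implies_Suc)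
  have "(\<Prod>i\<in>B. (f(j := \<lambda>x. f a x * f j x)) i x) = f a x * (\<Prod>i\<in>B. f i x)" if j: "j \<in> B" for j x
  proof -
    have "(\<Prod>i\<in>B - {j}. (f(j := \<lambda>x. f a x * f j x)) i x) = (\<Prod>i\<in>B - {j}. f i x)"
      by (rule prod.cong) auto
    then show ?thesis
      by (simp add: prod.remove[OF assms(1) j] mult.assoc del: fun_upd_apply) simp
  qed
  then show ?thesis
    using assms by (simp add: n algebra_simps del: fun_upd_apply)
qed

text \<open>This is Moebius inversion over set partitions. The induction keeps \<open>f\<close>
  arbitrary because the recursion also calls for the modified families
  \<open>f(j := \<lambda>x. f a x * f j x)\<close>.\<close>

lemma sum_inj_prod_eq_sum_partitions:
  fixes f :: "'a \<Rightarrow> 'b \<Rightarrow> 'c::{comm_ring_1,ring_char_0}"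
  assumes "finite A" "finite X"
  shows "(\<Sum>g | g \<in> A \<rightarrow>\<^sub>E X \<and> inj_on g A. \<Prod>i\<in>A. f i (g i)) =
    (\<Sum>P | partition_on A P. \<Prod>B\<in>P. block_weight f X B)"
  using assms(1)
proof (induction A arbitrary: f rule: finite_induct)
  case empty
  show ?case by (simp add: partition_on_empty)
next
  case (insert a A)
  let ?f = "\<lambda>j. f(j := \<lambda>x. f a x * f j x)"
  let ?w = "block_weight f X"
  \<comment> \<open>The partitions extending a fixed \<open>P\<close> by \<open>a\<close> already
    reproduce the recursion for injective maps; it remains to sum over \<open>P\<close>.\<close>
  have split: "(\<Prod>B\<in>insert {a} P. ?w B) + (\<Sum>B\<in>P. \<Prod>C\<in>insert (insert a B) (P - {B}). ?w C) =
      (\<Sum>x\<in>X. f a x) * (\<Prod>B\<in>P. ?w B) - (\<Sum>j\<in>A. \<Prod>B\<in>P. block_weight (?f j) X B)"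
    if P: "partition_on A P" for P
  proof -
    have finP: "finite P" using finite_elements[OF insert.hyps(1) P] .
    have notin: "a \<notin> B" if "B \<in> P" for B
      using P insert.hyps(2) that unfolding partition_on_def by blast
    have finB: "finite B" "B \<noteq> {}" if "B \<in> P" for B
      using P insert.hyps(1) that unfolding partition_on_def by (auto intro: finite_subset)
    have "{a} \<notin> P" using notin by blast
    then have 1: "(\<Prod>B\<in>insert {a} P. ?w B) = (\<Sum>x\<in>X. f a x) * (\<Prod>B\<in>P. ?w B)"
      using finP by simp
    have 2: "(\<Prod>C\<in>insert (insert a B) (P - {B}). ?w C) =
        - (\<Sum>j\<in>B. \<Prod>C\<in>P. block_weight (?f j) X C)" if B: "B \<in> P" for B
    proof -
      have "insert a B \<notin> P - {B}" using notin by blast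
      then have "(\<Prod>C\<in>insert (insert a B) (P - {B}). ?w C) = ?w (insert a B) * (\<Prod>C\<in>P - {B}. ?w C)"
        using finP by simp
      also have "\<dots> = - (\<Sum>j\<in>B. block_weight (?f j) X B * (\<Prod>C\<in>P - {B}. ?w C))"
        unfolding block_weight_insert[OF finB[OF B] notin[OF B]] by (simp add: sum_distrib_right)
      also have "(\<Sum>j\<in>B. block_weight (?f j) X B * (\<Prod>C\<in>P - {B}. ?w C)) =
          (\<Sum>j\<in>B. \<Prod>C\<in>P. block_weight (?f j) X C)"
      proof (rule sum.cong[OF refl])
        fix j assume j: "j \<in> B"
        \<comment> \<open>Blocks are disjoint, so \<open>j\<close> lies in no block other than
          \<open>B\<close> and the update at \<open>j\<close> leaves their weights
          unchanged.\<close>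
        have "(\<Prod>C\<in>P - {B}. ?w C) = (\<Prod>C\<in>P - {B}. block_weight (?f j) X C)"
        proof (rule prod.cong[OF refl])
          fix C assume "C \<in> P - {B}"
          then have "j \<notin> C" using P B j unfolding partition_on_def disjoint_def by blast
          then have "(\<Prod>i\<in>C. f i x) = (\<Prod>i\<in>C. ?f j i x)" for x
            by (intro prod.cong) auto
          then show "?w C = block_weight (?f j) X C" by (simp only:)
        qed
        then show "block_weight (?f j) X B * (\<Prod>C\<in>P - {B}. ?w C) =
            (\<Prod>C\<in>P. block_weight (?f j) X C)"
          by (simp only: prod.remove[OF finP B])
      qed
      finally show ?thesis .
    qed
    \<comment> \<open>The indices \<open>j \<in> A\<close> are grouped by the block of
      \<open>P\<close> containing them.\<close>
    have "(\<Sum>j\<in>A. \<Prod>C\<in>P. block_weight (?f j) X C) =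
        (\<Sum>B\<in>P. \<Sum>j\<in>B. \<Prod>C\<in>P. block_weight (?f j) X C)"
      unfolding partition_onD1[OF P]
      by (rule sum.Union_disjoint_sets[unfolded comp_def])
        (use finB(1) partition_onD2[OF P] in blast)+
    with 1 show ?thesis
      by (simp only: sum.cong[OF refl 2] sum_negf) simp
  qed
  have "(\<Sum>Q | partition_on (insert a A) Q. \<Prod>B\<in>Q. ?w B) =
      (\<Sum>P | partition_on A P. (\<Sum>x\<in>X. f a x) * (\<Prod>B\<in>P. ?w B) -
        (\<Sum>j\<in>A. \<Prod>B\<in>P. block_weight (?f j) X B))"
    unfolding sum_partition_on_insert[OF insert.hyps]
    by (rule sum.cong[OF refl]) (use split in blast)
  also have "\<dots> = (\<Sum>x\<in>X. f a x) * (\<Sum>P | partition_on A P. \<Prod>B\<in>P. ?w B) -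
      (\<Sum>j\<in>A. \<Sum>P | partition_on A P. \<Prod>B\<in>P. block_weight (?f j) X B)"
    unfolding sum_subtractf sum_distrib_left by (subst sum.swap) (rule refl)
  finally show ?case
    unfolding sum_inj_prod_insert[OF insert.hyps assms(2)] insert.IH by (rule sym)
qed

section \<open>Power sums of roots of unity\<close>

text \<open>The sum is geometric with ratio \<open>\<zeta> powi n\<close>, an \<open>l\<close>-th
  root of unity. It vanishes unless the ratio is \<open>1\<close>, which by primitivity happens
  exactly when \<open>l\<close> divides \<open>n\<close>.\<close>

lemma sum_root_of_unity_powi:
  assumes "primitive_root_of_unity l \<zeta>"
  shows "(\<Sum>x\<in>{0..int l - 1}. \<zeta> powi (x * n)) = (if int l dvd n then of_nat l else 0)"
proof -
  have l: "l > 0" and zl: "\<zeta> ^ l = 1" and prim: "\<And>k. 0 < k \<Longrightarrow> k < l \<Longrightarrow> \<zeta> ^ k \<noteq> 1"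
    using assms by (auto simp: primitive_root_of_unity_def)
  have z0: "\<zeta> \<noteq> 0" using zl l by (auto simp: zero_power)
  let ?q = "\<zeta> powi n"
  have ql: "?q ^ l = 1"
  proof -
    have "?q ^ l = \<zeta> powi (n * int l)" by (simp only: power_int_mult power_int_of_nat)
    also have "\<dots> = (\<zeta> powi int l) powi n" by (simp only: power_int_mult[symmetric] mult.commute)
    finally show ?thesis by (simp add: zl)
  qed
  have "{0..int l - 1} = int ` {..<l}"
    unfolding lessThan_atLeast0 image_int_atLeastLessThan by auto
  then have "(\<Sum>x\<in>{0..int l - 1}. \<zeta> powi (x * n)) = (\<Sum>k<l. \<zeta> powi (n * int k))"
    by (simp only:) (simp add: sum.reindex mult.commute)
  also have "\<dots> = (\<Sum>k<l. ?q ^ k)" by (simp add: power_int_mult)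
  finally have "(\<Sum>x\<in>{0..int l - 1}. \<zeta> powi (x * n)) = (\<Sum>k<l. ?q ^ k)" .
  moreover have "?q = 1 \<longleftrightarrow> int l dvd n"
  proof
    assume "int l dvd n"
    then obtain m where "n = int l * m" by blast
    then show "?q = 1" by (simp add: power_int_mult zl)
  next
    assume q: "?q = 1"
    \<comment> \<open>Reducing \<open>n\<close> modulo \<open>l\<close> gives an exponent below
      \<open>l\<close>, where primitivity leaves only \<open>k = 0\<close>.\<close>
    define k where "k = nat (n mod int l)"
    have k: "int k = n mod int l" "k < l" using l by (auto simp: k_def nat_less_iff)
    have "?q = \<zeta> powi (int l * (n div int l) + int k)" using k by simp
    also have "\<dots> = \<zeta> ^ k"
      using z0 by (simp add: power_int_add power_int_mult zl)
    finally have "k = 0" using q prim k(2) by (metis neq0_conv)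
    then show "int l dvd n" using k(1) by (simp add: dvd_eq_mod_eq_0)
  qed
  ultimately show ?thesis
    using ql by (auto simp: geometric_sum)
qed

lemma powi_sum:
  fixes z :: "'a::field"
  assumes "z \<noteq> 0"
  shows "z powi (\<Sum>i\<in>A. f i) = (\<Prod>i\<in>A. z powi f i)"
  using assms by (induction A rule: infinite_finite_induct) (auto simp: power_int_add)

section \<open>From index tuples to the closed formula\<close>

text \<open>Lists of length \<open>r\<close> correspond to functions on \<open>{..<r}\<close>, with
  \<open>distinct\<close> becoming \<open>inj_on\<close>. The argument of \<open>F\<close> is
  restricted so that it is extensional.\<close>

lemma sum_index_tuples:
  "(\<Sum>\<iota>\<in>index_tuples l r. F (\<lambda>i\<in>{..<r}. \<iota> ! i)) =
    (\<Sum>g | g \<in> {..<r} \<rightarrow>\<^sub>E {0..int l - 1} \<and> inj_on g {..<r}. F g)"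
proof (rule sum.reindex_bij_witness[where i = "\<lambda>g. map g [0..<r]" and j = "\<lambda>\<iota>. \<lambda>i\<in>{..<r}. \<iota> ! i"])
  fix \<iota> assume "\<iota> \<in> index_tuples l r"
  then have \<iota>: "length \<iota> = r" "distinct \<iota>" "set \<iota> \<subseteq> {0..int l - 1}"
    by (auto simp: index_tuples_def)
  then show "map (\<lambda>i\<in>{..<r}. \<iota> ! i) [0..<r] = \<iota>"
    by (auto intro: nth_equalityI)
  have "\<iota> ! i \<in> {0..int l - 1}" if "i < r" for i
    using \<iota> that nth_mem by blast
  then show "(\<lambda>i\<in>{..<r}. \<iota> ! i) \<in> {g. g \<in> {..<r} \<rightarrow>\<^sub>E {0..int l - 1} \<and> inj_on g {..<r}}"
    using \<iota> by (auto simp: inj_on_def nth_eq_iff_index_eq)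
next
  fix g assume "g \<in> {g. g \<in> {..<r} \<rightarrow>\<^sub>E {0..int l - 1} \<and> inj_on g {..<r}}"
  then have g: "g \<in> {..<r} \<rightarrow>\<^sub>E {0..int l - 1}" "inj_on g {..<r}" by auto
  then show "(\<lambda>i\<in>{..<r}. map g [0..<r] ! i) = g"
    by (auto simp: fun_eq_iff PiE_def extensional_def)
  show "map g [0..<r] \<in> index_tuples l r"
    using g by (auto simp: index_tuples_def distinct_map atLeast0LessThan)
qed (rule refl)

theorem lemma1:
  fixes l :: nat and \<zeta> :: complex and lam :: "int list"
  assumes "l \<ge> 1"
    and "primitive_root_of_unity l \<zeta>"
    and "is_partition lam"
  shows "Sigma_sum \<zeta> lam l =
    (\<Sum>J\<in>admissible_partitions l lam.
       of_nat l ^ card J * (\<Prod>B\<in>J. (-1) ^ (card B - 1) * fact (card B - 1)))"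
proof -
  let ?A = "{..<length lam}" and ?X = "{0..int l - 1}"
  let ?c = "\<lambda>B. (-1) ^ (card B - 1) * fact (card B - 1) :: complex"
  have z0: "\<zeta> \<noteq> 0"
    using assms(2) by (auto simp: primitive_root_of_unity_def zero_power)
  \<comment> \<open>The product over \<open>B\<close> has exponent \<open>x\<close> times the sum of
    the parts in \<open>B\<close>, so the power sum of the block is a single sum of powers of
    \<open>\<zeta>\<close>.\<close>
  have block: "(\<Sum>x\<in>?X. \<Prod>i\<in>B. \<zeta> powi (x * lam ! i)) =
      (if int l dvd (\<Sum>i\<in>B. lam ! i) then of_nat l else 0)" for B
    by (simp only: powi_sum[OF z0, symmetric] sum_distrib_left[symmetric]
        sum_root_of_unity_powi[OF assms(2)])
  have "Sigma_sum \<zeta> lam l =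
      (\<Sum>\<iota>\<in>index_tuples l (length lam). \<Prod>i\<in>?A. \<zeta> powi ((\<lambda>i\<in>?A. \<iota> ! i) i * lam ! i))"
    unfolding Sigma_sum_def powi_sum[OF z0] by (intro sum.cong prod.cong) auto
  also have "\<dots> = (\<Sum>g | g \<in> ?A \<rightarrow>\<^sub>E ?X \<and> inj_on g ?A. \<Prod>i\<in>?A. \<zeta> powi (g i * lam ! i))"
    by (rule sum_index_tuples)
  also have "\<dots> = (\<Sum>P | partition_on ?A P. \<Prod>B\<in>P.
      ?c B * (if int l dvd (\<Sum>i\<in>B. lam ! i) then of_nat l else 0))"
    unfolding block[symmetric]
    by (rule sum_inj_prod_eq_sum_partitions[where f = "\<lambda>i x. \<zeta> powi (x * lam ! i)"]) auto
  also have "\<dots> = (\<Sum>P\<in>admissible_partitions l lam. \<Prod>B\<in>P.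
      ?c B * (if int l dvd (\<Sum>i\<in>B. lam ! i) then of_nat l else 0))"
  \<comment> \<open>A partition that is not admissible has a block whose power sum is
    \<open>0\<close>, which annihilates its product.\<close>
  proof (rule sum.mono_neutral_right)
    show "finite {P. partition_on ?A P}" by (rule finitely_many_partition_on) simp
    show "\<forall>P\<in>{P. partition_on ?A P} - admissible_partitions l lam. (\<Prod>B\<in>P.
        ?c B * (if int l dvd (\<Sum>i\<in>B. lam ! i) then of_nat l else 0)) = 0"
    proof
      fix P assume P: "P \<in> {P. partition_on ?A P} - admissible_partitions l lam"
      then have "finite P" by (auto intro: finite_elements[of ?A])
      moreover obtain B where "B \<in> P" "\<not> int l dvd (\<Sum>i\<in>B. lam ! i)"
        using P by (auto simp: admissible_partitions_def)
      ultimately show "(\<Prod>B\<in>P.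
          ?c B * (if int l dvd (\<Sum>i\<in>B. lam ! i) then of_nat l else 0)) = 0"
        by (intro prod_zero) auto
    qed
  qed (auto simp: admissible_partitions_def)
  also have "\<dots> = (\<Sum>J\<in>admissible_partitions l lam. of_nat l ^ card J * (\<Prod>B\<in>J. ?c B))"
  proof (rule sum.cong[OF refl])
    fix J assume "J \<in> admissible_partitions l lam"
    then have "(\<Prod>B\<in>J. ?c B * (if int l dvd (\<Sum>i\<in>B. lam ! i) then of_nat l else 0)) =
        (\<Prod>B\<in>J. ?c B * of_nat l)"
      \<comment> \<open>In an admissible partition every block contributes a factor
        \<open>l\<close>; together these give \<open>of_nat l ^ card J\<close>.\<close>
      by (intro prod.cong) (auto simp: admissible_partitions_def)
    then show "(\<Prod>B\<in>J. ?c B * (if int l dvd (\<Sum>i\<in>B. lam ! i) then of_nat l else 0)) =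
        of_nat l ^ card J * (\<Prod>B\<in>J. ?c B)"
      by (simp add: prod.distrib mult.commute)
  qed
  finally show ?thesis .
qed

end
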